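(* Let $\mathcal{M} \in \{0,\ast,?\}^{p\times q}$ be a pattern matrix with $p\leq q$. Then $\mathcal{M}$ has full row rank if and only if the directed graph $G(\mathcal{M})$ is colorable.
   Context: A pattern matrix is a matrix with entries in the set of symbols $\{0,\ast,?\}$. For a $p\times q$ pattern matrix $\mathcal{M}$, its pattern class is $\mathcal{P}(\mathcal{M}) := \{M\in\mathbb{R}^{p\times q} \mid M_{ij}=0 \text{ if } \mathcal{M}_{ij}=0,\ M_{ij}\neq 0 \text{ if } \mathcal{M}_{ij}=\ast\}$; entries with $\mathcal{M}_{ij}=\;?$ are unrestricted. A pattern matrix $\mathcal{M}$ is said to have full row rank if every $M\in\mathcal{P}(\mathcal{M})$ has full row rank. For $\mathcal{M}\in\{0,\ast,?\}^{p\times q}$ with $p\le q$, the directed graph $G(\mathcal{M})=(V,E)$ has node set $V=\{1,2,\ldots,q\}$ and edge set $E\subseteq V\times V$ (self-loops allowed) where $(j,i)\in E$ if and only if $\mathcal{M}_{ij}=\ast$ or $\mathcal{M}_{ij}=\;?$. The edge set is partitioned as $E=E_\ast\cup E_?$, where $(j,i)\in E_\ast$ iff $\mathcal{M}_{ij}=\ast$ and $(j,i)\in E_?$ iff $\mathcal{M}_{ij}=\;?$. If $(i,j)\in E$, then $j$ is called an out-neighbor of $i$ (a node with a self-loop is an out-neighbor of itself). Colorability of $G(\mathcal{M})$ is defined by the following procedure: (1) initially color all nodes white; (2) (color change rule) if a node $i$ (of any color) has exactly one white out-neighbor $j$ and $(i,j)\in E_\ast$, change the color of $j$ to black; (3)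 repeat step 2 until no more color changes are possible. $G(\mathcal{M})$ is colorable if the nodes $1,2,\ldots,p$ are all colored black following this procedure (nodes $p+1,\ldots,q$ have no incoming edges and always stay white). *)

theory Defs
  imports "Jordan_Normal_Form.DL_Rank" "Graph_Theory.Pair_Digraph"
begin

datatype pattern_symbol = Zero | Star | Quest

text \<open>
  As everywhere in the matrix library, rows, columns and hence the nodes of the graph below are
  counted from 0: node \<open>k\<close> of the literature is node \<open>k - 1\<close> here.
\<close>

definition pattern_class :: "pattern_symbol mat \<Rightarrow> real mat set" where
  "pattern_class P = {M \<in> carrier_mat (dim_row P) (dim_col P).
     \<forall>i < dim_row P. \<forall>j < dim_col P.
       (P $$ (i, j) = Zero \<longrightarrow> M $$ (i, j) = 0) \<and>
       (P $$ (i, j) = Star \<longrightarrow> M $$ (i, j) \<noteq> 0)}"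

text \<open>The first argument of \<open>vec_space.rank\<close> is the number of rows of the matrix.\<close>

definition full_row_rank :: "real mat \<Rightarrow> bool" where
  "full_row_rank M \<longleftrightarrow> vec_space.rank (dim_row M) M = dim_row M"

definition pattern_full_row_rank :: "pattern_symbol mat \<Rightarrow> bool" where
  "pattern_full_row_rank P \<longleftrightarrow> (\<forall>M \<in> pattern_class P. full_row_rank M)"

record 'a partitioned_digraph = "'a pair_pre_digraph" +
  star_arcs :: "'a rel"
  quest_arcs :: "'a rel"

text \<open>The entry in row \<open>i\<close> and column \<open>j\<close> gives the arc from \<open>j\<close> to \<open>i\<close>.\<close>

definition pattern_graph :: "pattern_symbol mat \<Rightarrow> nat partitioned_digraph" where
  "pattern_graph P = \<lparr>
     pverts = {0..<dim_col P},
     parcs = {(j, i). i < dim_row P \<and> j < dim_col P \<and> (P $$ (i, j) = Star \<or> P $$ (i, j) = Quest)},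
     star_arcs = {(j, i). i < dim_row P \<and> j < dim_col P \<and> P $$ (i, j) = Star},
     quest_arcs = {(j, i). i < dim_row P \<and> j < dim_col P \<and> P $$ (i, j) = Quest}\<rparr>"

definition out_neighbors :: "('a, 'b) partitioned_digraph_scheme \<Rightarrow> 'a \<Rightarrow> 'a set" where
  "out_neighbors G i = {j. (i, j) \<in> parcs G}"

text \<open>A colouring is represented by its set \<open>B\<close> of black nodes; all other nodes are white.\<close>

definition color_change ::
    "('a, 'b) partitioned_digraph_scheme \<Rightarrow> 'a set \<Rightarrow> 'a set \<Rightarrow> bool" where
  "color_change G B B' \<longleftrightarrow>
     (\<exists>i \<in> pverts G. \<exists>j. out_neighbors G i - B = {j} \<and> (i, j) \<in> star_arcs G \<and> B' = insert j B)"

definition final_coloring :: "('a, 'b) partitioned_digraph_scheme \<Rightarrow> 'a set \<Rightarrow> bool" where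
  "final_coloring G B \<longleftrightarrow> (color_change G)\<^sup>*\<^sup>* {} B \<and> (\<nexists>B'. color_change G B B')"

text \<open>
  A final coloring is unique (\<open>final_coloring_unique\<close> below), so the order of the colour
  changes does not matter; on a finite graph one always exists.
\<close>

definition colorable :: "nat \<Rightarrow> (nat, 'b) partitioned_digraph_scheme \<Rightarrow> bool" where
  "colorable p G \<longleftrightarrow> (\<exists>B. final_coloring G B \<and> {0..<p} \<subseteq> B)"

lemma color_change_subset:
  assumes "(color_change G)\<^sup>*\<^sup>* {} B" "\<nexists>C'. color_change G C C'"
  shows "B \<subseteq> C"
  using assms(1)
proof (induction rule: rtranclp_induct)
  case base
  show ?case by simp
next
  case (step B B')
  from step.hyps(2) obtain i j where ij: "i \<in> pverts G" "out_neighbors G i - B = {j}"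
    "(i, j) \<in> star_arcs G" "B' = insert j B"
    unfolding color_change_def by blast
  have "j \<in> C"
  proof (rule ccontr)
    assume "j \<notin> C"
    then have "out_neighbors G i - C = {j}" using ij(2) step.IH by blast
    then have "color_change G C (insert j C)" using ij unfolding color_change_def by blast
    then show False using assms(2) by blast
  qed
  then show ?case using step.IH ij(4) by simp
qed

lemma final_coloring_unique:
  assumes "final_coloring G B" "final_coloring G C"
  shows "B = C"
  using assms color_change_subset unfolding final_coloring_def by (metis subset_antisym)

end

theory Submission
  imports Defs
begin

text \<open>
  A matrix has full row rank iff only the zero vector is orthogonal to all its columns
  (\<open>rank_eq_dim_row_iff\<close>), so the theorem is about the vectors \<open>v\<close> in the left kernels of the
  members of the pattern class.

  A colour change forces a coordinate of such a \<open>v\<close> to vanish. Suppose that \<open>v\<close> is zero on all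
  black nodes and that node \<open>i\<close> has the single white out-neighbour \<open>j\<close>, by a star arc. In
  the equation given by column \<open>i\<close>, every term except the one of row \<open>j\<close> then has a zero factor, and
  the coefficient of \<open>v j\<close> is nonzero; so \<open>v j = 0\<close>. If all rows get black, then \<open>v = 0\<close>.

  Conversely, let the procedure stop with a nonempty set \<open>W\<close> of white rows. No node has exactly one
  out-neighbour in \<open>W\<close> with a star arc to it, and this is just what is needed to fill each column of
  the pattern so that its entries in \<open>W\<close> sum to zero (\<open>pattern_zero_sum\<close>). The indicator vector of
  \<open>W\<close> is then in the left kernel of the matrix obtained.
\<close>

section \<open>Full row rank in terms of orthogonal vectors\<close>

context vec_space
begin

text \<open>
  The vector comes from the kernel of a square matrix that has the vectors of \<open>S\<close> among its rows; as
  \<open>S\<close> is small, there is room for a zero row, which makes the determinant vanish.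
\<close>

lemma exists_nonzero_orthogonal:
  fixes S :: "'a vec set"
  assumes S: "finite S" "S \<subseteq> carrier_vec n" and card: "card S < n"
  obtains v where "v \<in> orthogonal_complement S" "v \<noteq> 0\<^sub>v n"
proof -
  obtain us where us: "set us = S" "length us = card S"
    using finite_distinct_list[OF S(1)] distinct_card by metis
  have us_carrier: "us ! i \<in> carrier_vec n" if "i < card S" for i
    using us S(2) that by (metis nth_mem subsetD)
  define A where "A = mat\<^sub>r n n (\<lambda>i. if i = card S then 0\<^sub>v n else if i < card S then us ! i else 0\<^sub>v n)"
  have A: "A \<in> carrier_mat n n"
    by (simp add: A_def)
  have "det A = 0"
    unfolding A_def by (rule det_row_0[OF card]) (simp add: us_carrier)
  then obtain v where v: "v \<in> carrier_vec n" "v \<noteq> 0\<^sub>v n" "A *\<^sub>v v = 0\<^sub>v n"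
    using det_0_iff_vec_prod_zero_field[OF A] by blast
  have "v \<bullet> u = 0" if "u \<in> S" for u
  proof -
    from that us obtain i where i: "i < card S" "u = us ! i"
      by (metis in_set_conv_nth)
    have u: "u \<in> carrier_vec n"
      using that S(2) by blast
    have "row A i = u"
      unfolding A_def by (subst row_mat_of_row_fun) (use i card u in auto)
    moreover have "(A *\<^sub>v v) $ i = row A i \<bullet> v"
      using i card A by (intro index_mult_mat_vec) auto
    moreover have "(A *\<^sub>v v) $ i = 0"
      using v(3) i card by simp
    ultimately show ?thesis
      using comm_scalar_prod[OF v(1) u] by simp
  qed
  then show thesis
    using that v(1,2) unfolding orthogonal_complement_def by blast
qed

text \<open>
  A maximal independent set of columns has the span of all columns, hence the same orthogonal
  complement. If it has \<open>n\<close> elements, it spans the whole space, unit vectors included; otherwise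
  the preceding lemma applies to it.
\<close>

lemma rank_eq_dim_row_iff:
  assumes A: "A \<in> carrier_mat n m"
  shows "rank A = n \<longleftrightarrow> orthogonal_complement (set (cols A)) = {0\<^sub>v n}"
proof -
  have cols: "set (cols A) \<subseteq> carrier_vec n"
    using A cols_dim by blast
  obtain S where S: "finite S" "maximal S (\<lambda>T. T \<subseteq> set (cols A) \<and> lin_indpt T)"
    using maximal_exists[of "\<lambda>T. T \<subseteq> set (cols A) \<and> lin_indpt T" "card (set (cols A))" "{}"]
    by (meson List.finite_set card_mono empty_iff empty_subsetI finite_lin_indpt2 rev_finite_subset)
  have sub: "S \<subseteq> set (cols A)" and indep: "lin_indpt S"
    using S(2) by (auto simp: maximal_def)
  have carr: "S \<subseteq> carrier_vec n"
    using sub cols by blast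
  have rank: "rank A = card S"
    by (rule rank_card_indpt[OF A S(2)])
  have "x \<in> span S" if x: "x \<in> set (cols A)" for x
  proof (cases "x \<in> S")
    case True
    then show ?thesis using span_mem carr by blast
  next
    case False
    have "lin_dep (insert x S)"
    proof (rule ccontr)
      assume "\<not> lin_dep (insert x S)"
      then have "insert x S = S"
        using S(2) x sub unfolding maximal_def by blast
      then show False using False by blast
    qed
    then show ?thesis
      using lin_dep_iff_in_span[of S x] carr indep x cols False by auto
  qed
  then have "orthogonal_complement (span S) \<subseteq> orthogonal_complement (set (cols A))"
    by (intro orthogonal_complement_subset) blast
  then have compl: "orthogonal_complement (set (cols A)) = orthogonal_complement S"
    using orthogonal_complement_subset[OF sub] carr by auto
  have zero: "0\<^sub>v n \<in> orthogonal_complement S"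
    using carr unfolding orthogonal_complement_def by auto
  show ?thesis
  proof
    assume "rank A = n"
    then have "basis S"
      using rank dim_is_n by (intro dim_li_is_basis) (use S(1) carr indep in auto)
    then have "span S = carrier_vec n"
      by (simp add: basis_def)
    then have "orthogonal_complement S = orthogonal_complement (carrier_vec n)"
      using carr by (metis in_orthogonal_complement_span)
    moreover have "v = 0\<^sub>v n" if "v \<in> orthogonal_complement (carrier_vec n)" for v :: "'a vec"
    proof (rule eq_vecI)
      fix i assume "i < dim_vec (0\<^sub>v n)"
      then have i: "i < n" by simp
      have "v \<bullet> unit_vec n i = 0" "v \<in> carrier_vec n"
        using that unfolding orthogonal_complement_def by auto
      then show "v $ i = 0\<^sub>v n $ i"
        using i by (simp add: scalar_prod_right_unit)
    qed (use that in \<open>auto simp: orthogonal_complement_def\<close>)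
    ultimately show "orthogonal_complement (set (cols A)) = {0\<^sub>v n}"
      using compl zero by blast
  next
    assume "orthogonal_complement (set (cols A)) = {0\<^sub>v n}"
    then have "\<not> card S < n"
      using exists_nonzero_orthogonal[OF S(1) carr] compl by blast
    moreover have "card S \<le> n"
      using li_le_dim(2)[of S] carr indep dim_is_n by auto
    ultimately show "rank A = n"
      using rank by simp
  qed
qed

end

lemma full_row_rank_iff:
  assumes M: "M \<in> carrier_mat p q"
  shows "full_row_rank M \<longleftrightarrow>
    (\<forall>v. (\<forall>j<q. (\<Sum>i<p. v i * M $$ (i, j)) = 0) \<longrightarrow> (\<forall>i<p. v i = 0))"
proof -
  have prod: "u \<bullet> col M j = (\<Sum>i<p. u $ i * M $$ (i, j))" if "j < q" for u j
    using M that by (auto simp: scalar_prod_def lessThan_atLeast0 intro!: sum.cong)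
  have cols: "set (cols M) = col M ` {..<q}"
    using M by (auto simp: cols_def)
  have orth: "vec_module.orthogonal_complement p (set (cols M)) =
      {u \<in> carrier_vec p. \<forall>j<q. (\<Sum>i<p. u $ i * M $$ (i, j)) = 0}"
    unfolding vec_module.orthogonal_complement_def cols by (auto simp: prod)
  have rank: "full_row_rank M \<longleftrightarrow> vec_module.orthogonal_complement p (set (cols M)) = {0\<^sub>v p}"
    using M by (simp add: full_row_rank_def vec_space.rank_eq_dim_row_iff)
  show ?thesis
  proof
    assume full: "full_row_rank M"
    show "\<forall>v. (\<forall>j<q. (\<Sum>i<p. v i * M $$ (i, j)) = 0) \<longrightarrow> (\<forall>i<p. v i = 0)"
    proof (intro allI impI)
      fix v :: "nat \<Rightarrow> real" and i
      assume ker: "\<forall>j<q. (\<Sum>i<p. v i * M $$ (i, j)) = 0" and i: "i < p"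
      have "vec p v \<in> vec_module.orthogonal_complement p (set (cols M))"
        unfolding orth using ker by simp
      then have "vec p v = 0\<^sub>v p"
        using full rank by simp
      then show "v i = 0"
        using i by (metis index_vec index_zero_vec(1))
    qed
  next
    assume trivial: "\<forall>v. (\<forall>j<q. (\<Sum>i<p. v i * M $$ (i, j)) = 0) \<longrightarrow> (\<forall>i<p. v i = 0)"
    have "u = 0\<^sub>v p" if u: "u \<in> vec_module.orthogonal_complement p (set (cols M))" for u
    proof -
      have "\<forall>i<p. u $ i = 0" "u \<in> carrier_vec p"
        using u spec[OF trivial, of "\<lambda>i. u $ i"] unfolding orth by blast+
      then show ?thesis
        by (intro eq_vecI) auto
    qed
    moreover have "0\<^sub>v p \<in> vec_module.orthogonal_complement p (set (cols M))"
      unfolding orth by simp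
    ultimately show "full_row_rank M"
      unfolding rank by blast
  qed
qed

section \<open>Colour changes and the left kernel\<close>

lemma pattern_class_nonzero_entryD:
  assumes "M \<in> pattern_class P" "i < dim_row P" "j < dim_col P" "M $$ (i, j) \<noteq> 0"
  shows "i \<in> out_neighbors (pattern_graph P) j"
proof -
  have "P $$ (i, j) \<noteq> Zero"
    using assms by (auto simp: pattern_class_def)
  then have "P $$ (i, j) = Star \<or> P $$ (i, j) = Quest"
    by (cases "P $$ (i, j)") auto
  then show ?thesis
    using assms(2,3) by (simp add: out_neighbors_def pattern_graph_def)
qed

text \<open>
  Every colour change reads off one more vanishing coordinate from the equation of the column of
  the node that causes it.
\<close>

lemma left_kernel_zero_on_black:
  assumes M: "M \<in> pattern_class P"
    and ker: "\<And>j. j < dim_col P \<Longrightarrow> (\<Sum>i<dim_row P. v i * M $$ (i, j)) = (0::real)"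
    and "(color_change (pattern_graph P))\<^sup>*\<^sup>* {} B"
  shows "\<forall>i\<in>B. v i = 0"
  using assms(3)
proof (induction rule: rtranclp_induct)
  case base
  show ?case by simp
next
  case (step B B')
  let ?G = "pattern_graph P"
  from step.hyps(2) obtain j k where jk: "j \<in> pverts ?G" "out_neighbors ?G j - B = {k}"
    "(j, k) \<in> star_arcs ?G" "B' = insert k B"
    unfolding color_change_def by blast
  have j: "j < dim_col P" and k: "k < dim_row P" and star: "P $$ (k, j) = Star"
    using jk(1,3) by (auto simp: pattern_graph_def)
  have "v i * M $$ (i, j) = 0" if "i \<in> {..<dim_row P} - {k}" for i
  proof (cases "M $$ (i, j) = 0")
    case False
    then have "i \<in> out_neighbors ?G j"
      using pattern_class_nonzero_entryD[OF M] that j by auto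
    then have "i \<in> B" using jk(2) that by blast
    then show ?thesis using step.IH by simp
  qed simp
  then have "(\<Sum>i\<in>{..<dim_row P} - {k}. v i * M $$ (i, j)) = 0"
    by (intro sum.neutral ballI)
  then have "(\<Sum>i<dim_row P. v i * M $$ (i, j)) = v k * M $$ (k, j)"
    using k sum.remove[of "{..<dim_row P}" k "\<lambda>i. v i * M $$ (i, j)"] by simp
  moreover have "M $$ (k, j) \<noteq> 0"
    using M star j k unfolding pattern_class_def by auto
  ultimately have "v k = 0"
    using ker[OF j] by simp
  then show ?case using step.IH jk(4) by simp
qed

section \<open>A rank-deficient member from a stuck colouring\<close>

text \<open>
  The set \<open>S\<close> carries the stars and \<open>U\<close> the question marks of a column. All stars get the value 1
  except for one place \<open>d\<close>, which compensates for them. If \<open>S\<close> has a single element, a compensating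
  value at that element would be 0, so \<open>d\<close> must be taken from \<open>U\<close>.
\<close>

lemma pattern_zero_sum:
  fixes S U :: "'a set"
  assumes fin: "finite S" "finite U" and disj: "S \<inter> U = {}"
    and stuck: "\<nexists>k. S \<union> U = {k} \<and> k \<in> S"
  obtains c :: "'a \<Rightarrow> real" where "\<forall>k\<in>S. c k \<noteq> 0" "\<forall>k. k \<notin> S \<union> U \<longrightarrow> c k = 0" "sum c (S \<union> U) = 0"
proof (cases "S = {}")
  case True
  then show ?thesis using that[of "\<lambda>_. 0"] by simp
next
  case False
  then obtain s where s: "s \<in> S" by blast
  with stuck obtain d where d: "d \<in> S \<union> U" "d \<noteq> s" by blast
  define c :: "'a \<Rightarrow> real" where
    "c k = (if k = d then - real (card (S - {d})) else if k \<in> S then 1 else 0)" for k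
  have "card (S - {d}) \<noteq> 0"
    using fin(1) s d(2) by auto
  moreover have "sum c (S \<union> U) = c d + sum c (S \<union> U - {d})"
    using fin d(1) by (simp add: sum.remove)
  moreover have "sum c (S \<union> U - {d}) = sum c (S - {d})"
    by (rule sum.mono_neutral_right) (use fin in \<open>auto simp: c_def\<close>)
  moreover have "sum c (S - {d}) = real (card (S - {d}))"
    by (simp add: c_def)
  ultimately show ?thesis
    using that[of c] d(1) by (auto simp: c_def)
qed

lemma stuck_coloring_rank_deficient:
  assumes stuck: "\<nexists>B'. color_change (pattern_graph P) B B'"
    and k0: "k0 < dim_row P" "k0 \<notin> B"
  shows "\<exists>M\<in>pattern_class P. \<not> full_row_rank M"
proof -
  let ?G = "pattern_graph P"
  define W where "W = {..<dim_row P} - B"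
  define S where "S j = {k \<in> W. P $$ (k, j) = Star}" for j
  define U where "U j = {k \<in> W. P $$ (k, j) = Quest}" for j
  have "\<exists>c. (\<forall>k\<in>S j. c k \<noteq> 0) \<and> (\<forall>k. k \<notin> S j \<union> U j \<longrightarrow> c k = 0) \<and> sum c (S j \<union> U j) = (0::real)"
    if j: "j < dim_col P" for j
  proof -
    have white: "S j \<union> U j = out_neighbors ?G j - B"
      using j by (auto simp: S_def U_def W_def out_neighbors_def pattern_graph_def)
    have "\<nexists>k. S j \<union> U j = {k} \<and> k \<in> S j"
    proof
      assume "\<exists>k. S j \<union> U j = {k} \<and> k \<in> S j"
      then obtain k where k: "S j \<union> U j = {k}" "k \<in> S j" by blast
      then have "(j, k) \<in> star_arcs ?G" "j \<in> pverts ?G"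
        using j by (auto simp: S_def W_def pattern_graph_def)
      then show False
        using stuck k(1) white unfolding color_change_def by metis
    qed
    moreover have "finite (S j)" "finite (U j)" "S j \<inter> U j = {}"
      by (auto simp: S_def U_def W_def)
    ultimately show ?thesis
      by (metis pattern_zero_sum)
  qed
  then obtain c where c: "\<And>j. j < dim_col P \<Longrightarrow> \<forall>k\<in>S j. c j k \<noteq> 0"
      "\<And>j. j < dim_col P \<Longrightarrow> \<forall>k. k \<notin> S j \<union> U j \<longrightarrow> c j k = 0"
      "\<And>j. j < dim_col P \<Longrightarrow> sum (c j) (S j \<union> U j) = (0::real)"
    by metis
  \<comment> \<open>Rows outside \<open>W\<close> do not meet the indicator vector; 1 serves for all their nonzero entries.\<close>
  define M where "M = mat (dim_row P) (dim_col P) (\<lambda>(k, j).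
    if k \<in> W then c j k else if P $$ (k, j) = Zero then 0 else 1)"
  have "M \<in> pattern_class P"
    using c(1,2) unfolding pattern_class_def M_def by (auto simp: S_def U_def)
  moreover have "\<not> full_row_rank M"
  proof
    assume full: "full_row_rank M"
    define v :: "nat \<Rightarrow> real" where "v k = (if k \<in> W then 1 else 0)" for k
    have M: "M \<in> carrier_mat (dim_row P) (dim_col P)"
      by (simp add: M_def)
    have "(\<Sum>k<dim_row P. v k * M $$ (k, j)) = 0" if j: "j < dim_col P" for j
    proof -
      have "(\<Sum>k<dim_row P. v k * M $$ (k, j)) = sum (c j) (S j \<union> U j)"
        by (rule sum.mono_neutral_cong_right)
          (use j c(2) in \<open>auto simp: v_def M_def S_def U_def W_def\<close>)
      then show ?thesis using c(3)[OF j] by simp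
    qed
    then have "v k0 = 0"
      using full k0 unfolding full_row_rank_iff[OF M] by blast
    then show False
      using k0 by (simp add: v_def W_def)
  qed
  ultimately show ?thesis by blast
qed

section \<open>The criterion\<close>

text \<open>Every colour change blackens a new row, so the procedure stops.\<close>

lemma final_coloring_exists:
  "\<exists>B. final_coloring (pattern_graph P) B"
proof -
  let ?G = "pattern_graph P"
  let ?R = "\<lambda>B. (color_change ?G)\<^sup>*\<^sup>* {} B"
  have bounded: "B \<subseteq> {..<dim_row P}" if "?R B" for B
    using that
  proof (induction rule: rtranclp_induct)
    case (step B C)
    then obtain i j where "(i, j) \<in> star_arcs ?G" "C = insert j B"
      unfolding color_change_def by blast
    then show ?case
      using step.IH by (simp add: pattern_graph_def)
  qed simp
  have card: "card B < Suc (dim_row P)" if "?R B" for B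
    using card_mono[OF _ bounded[OF that]] by simp
  obtain B where B: "?R B" "\<And>C. ?R C \<Longrightarrow> card C \<le> card B"
    using ex_has_greatest_nat[of ?R "{}" card "Suc (dim_row P)"] card by blast
  have "\<not> color_change ?G B C" for C
  proof
    assume change: "color_change ?G B C"
    then have "?R C" using B(1) by simp
    moreover have "B \<subset> C"
      using change unfolding color_change_def by blast
    moreover have "finite C"
      using bounded[OF \<open>?R C\<close>] finite_subset by blast
    ultimately show False
      using B(2) psubset_card_mono by (metis not_le)
  qed
  then show ?thesis using B(1) unfolding final_coloring_def by blast
qed

theorem theorem11:
  fixes P :: "pattern_symbol mat" and p q :: nat
  assumes "P \<in> carrier_mat p q" and "p \<le> q"
  shows "pattern_full_row_rank P \<longleftrightarrow> colorable p (pattern_graph P)"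
proof
  assume full: "pattern_full_row_rank P"
  obtain B where B: "final_coloring (pattern_graph P) B"
    using final_coloring_exists by blast
  have "k \<in> B" if "k < p" for k
  proof (rule ccontr)
    assume "k \<notin> B"
    moreover have "\<nexists>B'. color_change (pattern_graph P) B B'" "k < dim_row P"
      using B that assms(1) by (auto simp: final_coloring_def)
    ultimately show False
      using stuck_coloring_rank_deficient[of P B k] full unfolding pattern_full_row_rank_def by blast
  qed
  then have "{0..<p} \<subseteq> B"
    by auto
  then show "colorable p (pattern_graph P)"
    using B unfolding colorable_def by blast
next
  assume "colorable p (pattern_graph P)"
  then obtain B where B: "(color_change (pattern_graph P))\<^sup>*\<^sup>* {} B" "{0..<p} \<subseteq> B"
    unfolding colorable_def final_coloring_def by blast
  show "pattern_full_row_rank P"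
    unfolding pattern_full_row_rank_def
  proof
    fix M assume M: "M \<in> pattern_class P"
    then have carr: "M \<in> carrier_mat p q"
      using assms(1) by (auto simp: pattern_class_def)
    show "full_row_rank M"
      unfolding full_row_rank_iff[OF carr]
    proof (intro allI impI)
      fix v i
      assume "\<forall>j<q. (\<Sum>i<p. v i * M $$ (i, j)) = 0" and i: "i < p"
      then have "\<forall>i\<in>B. v i = 0"
        using left_kernel_zero_on_black[OF M _ B(1)] assms(1) by auto
      then show "v i = 0" using B(2) i by auto
    qed
  qed
qed

end
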